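(* Let $n\ge 4$ and $s$ be integers with $2 \leq s \leq \lfloor\frac{n}{2}\rfloor$, and let $S_{n,s}$ be the spire graph. Then $$rn(S_{n,s}) = \begin{cases} 2k^2 -4k + 2s +3 & \text{if } n = 2k \text{ and } 2 \leq s \leq k-2,\\ 2k^2 -2k & \text{if } n = 2k \text{ and } s= k-1,\\ 2k^2 -2k + 1 & \text{if } n = 2k \text{ and } s= k,\\ 2k^2 -2k + 2s & \text{if } n = 2k + 1. \end{cases}$$
   Context: For a connected graph $G$, $d(u,v)$ denotes the graph distance and $\mathrm{diam}(G)$ the diameter. A radio labeling of $G$ is a function $c:V(G)\to\mathbb{Z}_{+}$ (positive integers; $0$ is not allowed) such that for all distinct $u,v\in V(G)$, $d(u,v)+|c(u)-c(v)|\ge \mathrm{diam}(G)+1$. The span of $c$ is the maximum value of $c$, and the radio number $rn(G)$ is the minimum span over all radio labelings of $G$. For integers $n\ge 4$ and $2\le s\le n-2$, the spire graph $S_{n,s}$ has vertices $v_1,\dots,v_n$ and edges $\{v_i,v_{i+1}\}$ for $i=1,\dots,n-2$ together with the edge $\{v_s,v_n\}$ (so it is the path $v_1\cdots v_{n-1}$ with a pendant vertex $v_n$ attached to $v_s$). *)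

theory Defs
  imports Main
begin

text \<open>A finite simple graph is given by a vertex set \<open>V\<close> and a set \<open>E\<close> of
  two-element subsets of \<open>V\<close>.\<close>

text \<open>Least length of a walk from \<open>u\<close> to \<open>v\<close>. The value is meaningful only when \<open>v\<close> is
  reachable from \<open>u\<close>, so the notions below are intended for connected graphs.\<close>
definition gdist :: "'a set set \<Rightarrow> 'a \<Rightarrow> 'a \<Rightarrow> nat" where
  "gdist E u v = (LEAST k. (u, v) \<in> {(x, y). {x, y} \<in> E} ^^ k)"

definition gdiam :: "'a set \<Rightarrow> 'a set set \<Rightarrow> nat" where
  "gdiam V E = Max {gdist E u v | u v. u \<in> V \<and> v \<in> V}"

definition radio_labeling :: "'a set \<Rightarrow> 'a set set \<Rightarrow> ('a \<Rightarrow> nat) \<Rightarrow> bool" where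
  "radio_labeling V E c \<longleftrightarrow>
     (\<forall>v\<in>V. 0 < c v) \<and>
     (\<forall>u\<in>V. \<forall>v\<in>V. u \<noteq> v \<longrightarrow>
        int (gdist E u v) + \<bar>int (c u) - int (c v)\<bar> \<ge> int (gdiam V E) + 1)"

definition label_span :: "'a set \<Rightarrow> ('a \<Rightarrow> nat) \<Rightarrow> nat" where
  "label_span V c = Max (c ` V)"

definition radio_number :: "'a set \<Rightarrow> 'a set set \<Rightarrow> nat" where
  "radio_number V E = (LEAST m. \<exists>c. radio_labeling V E c \<and> label_span V c = m)"

text \<open>The spire graph, with vertex \<open>v\<^sub>i\<close> encoded as the number \<open>i\<close>; it is meant for
  \<open>4 \<le> n\<close> and \<open>2 \<le> s \<le> n - 2\<close>.\<close>
definition spire_verts :: "nat \<Rightarrow> nat set" where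
  "spire_verts n = {1..n}"

definition spire_edges :: "nat \<Rightarrow> nat \<Rightarrow> nat set set" where
  "spire_edges n s = {{i, i + 1} | i. 1 \<le> i \<and> i \<le> n - 2} \<union> {{s, n}}"

definition spire_rn :: "nat \<Rightarrow> nat \<Rightarrow> nat" where
  "spire_rn n s = radio_number (spire_verts n) (spire_edges n s)"

end

theory Submission
  imports Defs
begin

text \<open>
  Cutting the path at position \<open>A / 2\<close> bounds \<open>2 * d(u, v)\<close> by \<open>wt u + wt v\<close>, where \<open>wt\<close> is twice the
  distance to the cut. Summing the label gaps along the vertices ordered by label bounds the span from
  below, up to a nonnegative excess. With the cut at the vertex \<open>k\<close> this is already sharp for
  \<open>n = 2k + 1\<close> and for \<open>n = 2k\<close>, \<open>s = k\<close>. For \<open>n = 2k\<close>, \<open>s < k\<close> the cut is the edge between \<open>k - 1\<close> and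
  \<open>k\<close>, and the radio condition for vertices two apart in the ordering forces an excess around
  the far end \<open>2k - 1\<close>. If \<open>s \<le> k - 2\<close> and the excess were only one, the ordering would alternate between
  the two sides, and \<open>2k - 1\<close> and \<open>2k - 2\<close> would both have to be next to \<open>k - 1\<close>, which is first or
  last in the ordering. Explicit labelings attain the bounds.
\<close>

section \<open>Distances in the spire graph\<close>

text \<open>The vertex \<open>n\<close> is projected to its foot \<open>s\<close> on the path, and
  the pendant edge costs one more step. Integer values let later inequalities subtract
  freely.\<close>

definition spire_dist :: "nat \<Rightarrow> nat \<Rightarrow> nat \<Rightarrow> nat \<Rightarrow> int" where
  "spire_dist n s u v =
     \<bar>int (if u = n then s else u) - int (if v = n then s else v)\<bar>
     + (if (u = n) = (v = n) then 0 else 1)"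

lemma relpow_sym:
  assumes "sym R" and "(x, y) \<in> R ^^ k"
  shows "(y, x) \<in> R ^^ k"
  using assms(2)
proof (induction k arbitrary: y)
  case (Suc k)
  then obtain z where "(x, z) \<in> R ^^ k" "(z, y) \<in> R"
    by auto
  with Suc.IH assms(1) show ?case
    by (meson relpow_Suc_I2 symD)
qed simp

text \<open>Explicit walks give the upper bound. For the lower bound,
  \<open>spire_dist n s u\<close> vanishes at \<open>u\<close> and grows by at most one along each
  edge.\<close>

lemma gdist_spire:
  assumes s: "1 \<le> s" "s \<le> n - 1" and n: "2 \<le> n"
    and u: "u \<in> {1..n}" and v: "v \<in> {1..n}"
  shows "int (gdist (spire_edges n s) u v) = spire_dist n s u v"
proof -
  define R where "R = {(x, y). {x, y} \<in> spire_edges n s}"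
  have symR: "sym R"
    by (auto simp: R_def sym_def insert_commute)
  have path: "(i, i + m) \<in> R ^^ m" if "1 \<le> i" "i + m \<le> n - 1" for i m
    using that
  proof (induction m)
    case (Suc m)
    then have "(i + m, i + Suc m) \<in> R"
      by (auto simp: R_def spire_edges_def)
    with Suc show ?case by auto
  qed simp
  have walk: "(i, j) \<in> R ^^ nat \<bar>int i - int j\<bar>"
    if "1 \<le> i" "i \<le> n - 1" "1 \<le> j" "j \<le> n - 1" for i j
  proof (cases "i \<le> j")
    case True
    then show ?thesis using path[of i "j - i"] that by (simp add: nat_diff_distrib)
  next
    case False
    then show ?thesis
      using relpow_sym[OF symR path[of j "i - j"]] that by (simp add: nat_diff_distrib)
  qed
  have sn: "(s, n) \<in> R"
    by (auto simp: R_def spire_edges_def)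
  have pend: "(i, n) \<in> R ^^ nat (\<bar>int i - int s\<bar> + 1)" if "1 \<le> i" "i \<le> n - 1" for i
  proof -
    have "nat (\<bar>int i - int s\<bar> + 1) = Suc (nat \<bar>int i - int s\<bar>)" by simp
    with walk[of i s] that s sn show ?thesis by auto
  qed
  have upper: "(u, v) \<in> R ^^ nat (spire_dist n s u v)"
  proof -
    consider "u = n" "v = n" | "u = n" "v \<le> n - 1" | "u \<le> n - 1" "v = n" | "u \<le> n - 1" "v \<le> n - 1"
      using u v by fastforce
    then show ?thesis
    proof cases
      case 2
      then show ?thesis
        using relpow_sym[OF symR pend[of v]] v n by (simp add: spire_dist_def abs_minus_commute)
    next
      case 3
      then show ?thesis using pend[of u] u n by (simp add: spire_dist_def)
    next
      case 4
      then show ?thesis using walk[of u v] u v n by (auto simp: spire_dist_def)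
    qed (simp add: spire_dist_def)
  qed
  have lip: "spire_dist n s u z \<le> spire_dist n s u y + 1" if "(y, z) \<in> R" for y z
    using that n
    by (auto simp: R_def spire_edges_def doubleton_eq_iff spire_dist_def split: if_splits)
  have lower: "spire_dist n s u w \<le> int k" if "(u, w) \<in> R ^^ k" for w k
    using that
  proof (induction k arbitrary: w)
    case 0
    then show ?case by (simp add: spire_dist_def)
  next
    case (Suc k)
    then obtain y where "(u, y) \<in> R ^^ k" "(y, w) \<in> R" by auto
    with Suc.IH lip show ?case by fastforce
  qed
  have "gdist (spire_edges n s) u v = nat (spire_dist n s u v)"
    unfolding gdist_def R_def[symmetric]
    by (rule Least_equality) (use upper lower in \<open>auto simp: nat_le_iff\<close>)
  then show ?thesis by (simp add: spire_dist_def)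
qed

text \<open>The path ends \<open>1\<close> and \<open>n - 1\<close> realise the diameter. As
  \<open>s\<close> is an inner vertex of the path, the pendant vertex is at most as far from any
  vertex.\<close>

lemma gdiam_spire:
  assumes n: "4 \<le> n" and s: "2 \<le> s" "s \<le> n - 2"
  shows "gdiam (spire_verts n) (spire_edges n s) = n - 2"
proof -
  let ?D = "{gdist (spire_edges n s) u v |u v. u \<in> spire_verts n \<and> v \<in> spire_verts n}"
  have d: "int (gdist (spire_edges n s) u v) = spire_dist n s u v"
    if "u \<in> spire_verts n" "v \<in> spire_verts n" for u v
    using gdist_spire[of s n u v] n s that by (simp add: spire_verts_def)
  have le: "gdist (spire_edges n s) u v \<le> n - 2"
    if "u \<in> spire_verts n" "v \<in> spire_verts n" for u v
  proof -
    have "spire_dist n s u v \<le> int (n - 2)"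
      using that n s by (auto simp: spire_dist_def spire_verts_def)
    with d[OF that] show ?thesis by simp
  qed
  have "spire_dist n s 1 (n - 1) = int (n - 2)"
    using n by (auto simp: spire_dist_def)
  moreover have ends: "1 \<in> spire_verts n" "n - 1 \<in> spire_verts n"
    using n by (auto simp: spire_verts_def)
  ultimately have "gdist (spire_edges n s) 1 (n - 1) = n - 2"
    using d[OF ends] by (simp only: of_nat_eq_iff)
  with ends have "n - 2 \<in> ?D" by (metis (mono_tags, lifting) mem_Collect_eq)
  moreover have "finite ?D"
    by (rule finite_subset[of _ "{..n - 2}"]) (use le in auto)
  ultimately show ?thesis
    unfolding gdiam_def by (intro Max_eqI) (use le in auto)
qed

section \<open>Radio labelings and the radio number in terms of integer inequalities\<close>

lemma radio_labeling_spire_iff: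
  assumes n: "4 \<le> n" and s: "2 \<le> s" "s \<le> n - 2"
  shows "radio_labeling (spire_verts n) (spire_edges n s) c \<longleftrightarrow>
    (\<forall>v\<in>{1..n}. 0 < c v) \<and>
    (\<forall>u\<in>{1..n}. \<forall>v\<in>{1..n}. u \<noteq> v \<longrightarrow>
       int n - 1 \<le> spire_dist n s u v + \<bar>int (c u) - int (c v)\<bar>)"
proof -
  have "int (gdist (spire_edges n s) u v) = spire_dist n s u v"
    if "u \<in> {1..n}" "v \<in> {1..n}" for u v
    using gdist_spire[of s n u v] n s that by simp
  moreover have "int (gdiam (spire_verts n) (spire_edges n s)) + 1 = int n - 1"
    using gdiam_spire[OF n s] n by simp
  ultimately show ?thesis
    unfolding radio_labeling_def by (simp only:) (simp add: spire_verts_def)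
qed

text \<open>Interface for the explicit labelings: integer labels avoid truncated subtraction, and by
  symmetry of the distance the pairs \<open>u < v\<close> suffice.\<close>

lemma spire_rn_le:
  fixes C :: "nat \<Rightarrow> int"
  assumes n: "4 \<le> n" and s: "2 \<le> s" "s \<le> n - 2"
    and pos: "\<And>v. v \<in> {1..n} \<Longrightarrow> 1 \<le> C v"
    and rad: "\<And>u v. u \<in> {1..n} \<Longrightarrow> v \<in> {1..n} \<Longrightarrow> u < v \<Longrightarrow>
      int n - 1 \<le> spire_dist n s u v + \<bar>C u - C v\<bar>"
    and max: "\<And>v. v \<in> {1..n} \<Longrightarrow> C v \<le> M"
  shows "int (spire_rn n s) \<le> M"
proof -
  define c where "c v = nat (C v)" for v
  have ic: "int (c v) = C v" if "v \<in> {1..n}" for v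
    using pos[OF that] by (simp add: c_def)
  have "radio_labeling (spire_verts n) (spire_edges n s) c"
    unfolding radio_labeling_spire_iff[OF n s]
  proof (intro conjI ballI impI)
    fix v assume "v \<in> {1..n}"
    then show "0 < c v" using ic pos by fastforce
  next
    fix u v assume uv: "u \<in> {1..n}" "v \<in> {1..n}" "u \<noteq> v"
    have "spire_dist n s v u = spire_dist n s u v"
      by (auto simp: spire_dist_def)
    then show "int n - 1 \<le> spire_dist n s u v + \<bar>int (c u) - int (c v)\<bar>"
      using rad[of u v] rad[of v u] uv ic by (cases "u < v") (auto simp: abs_minus_commute)
  qed
  then have "spire_rn n s \<le> label_span (spire_verts n) c"
    unfolding spire_rn_def radio_number_def by (intro Least_le) blast
  moreover have "c v \<le> nat M" if "v \<in> {1..n}" for v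
    using max[OF that] by (simp add: c_def nat_mono)
  then have "label_span (spire_verts n) c \<le> nat M"
    unfolding label_span_def spire_verts_def using n by (subst Max_le_iff) auto
  moreover have "0 \<le> M" using pos[of 1] max[of 1] n by auto
  ultimately show ?thesis by linarith
qed

text \<open>Some radio labeling exists, so \<open>LEAST\<close> picks a genuine span, and a lower
  bound for all spans passes to the radio number.\<close>

lemma le_spire_rn:
  assumes n: "4 \<le> n" and s: "2 \<le> s" "s \<le> n - 2"
    and le: "\<And>c. radio_labeling (spire_verts n) (spire_edges n s) c \<Longrightarrow>
      M \<le> int (label_span (spire_verts n) c)"
  shows "M \<le> int (spire_rn n s)"
proof -
  \<comment> \<open>Distinct multiples of \<open>n\<close> differ by at least \<open>n\<close>,
    which meets the condition whatever the distance is.\<close>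
  have "radio_labeling (spire_verts n) (spire_edges n s) (\<lambda>v. n * v)"
    unfolding radio_labeling_spire_iff[OF n s]
  proof (intro conjI ballI impI)
    fix u v :: nat assume "u \<noteq> v"
    then have "1 \<le> \<bar>int u - int v\<bar>" by linarith
    then have "int n * 1 \<le> int n * \<bar>int u - int v\<bar>" by (intro mult_left_mono) auto
    then have "int n \<le> \<bar>int (n * u) - int (n * v)\<bar>"
      by (simp add: right_diff_distrib[symmetric] abs_mult)
    moreover have "0 \<le> spire_dist n s u v" by (simp add: spire_dist_def)
    ultimately show "int n - 1 \<le> spire_dist n s u v + \<bar>int (n * u) - int (n * v)\<bar>" by linarith
  qed (use n in auto)
  then have "\<exists>m c. radio_labeling (spire_verts n) (spire_edges n s) c
      \<and> label_span (spire_verts n) c = m" by blast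
  from LeastI_ex[OF this] obtain c where "radio_labeling (spire_verts n) (spire_edges n s) c"
    "label_span (spire_verts n) c = spire_rn n s"
    unfolding spire_rn_def radio_number_def by blast
  with le show ?thesis by metis
qed

section \<open>The lower bound\<close>

text \<open>Twice the distance to a cut of the path at position \<open>A / 2\<close>, provided \<open>2 * s \<le> A\<close>.\<close>
definition wt :: "nat \<Rightarrow> nat \<Rightarrow> int \<Rightarrow> nat \<Rightarrow> int" where
  "wt n s A v = (if v = n then A - 2 * int s + 2 else \<bar>2 * int v - A\<bar>)"

text \<open>Triangle inequality through the cut. Since \<open>s\<close> is not to the right of the
  cut, the pendant vertex reaches it through \<open>s\<close> at doubled cost
  \<open>A - 2 * s + 2\<close>.\<close>

lemma dist_le_wt:
  assumes "2 * int s \<le> A" "u \<noteq> v"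
  shows "2 * spire_dist n s u v \<le> wt n s A u + wt n s A v"
proof -
  have "2 * \<bar>a - b\<bar> \<le> \<bar>2 * a - A\<bar> + \<bar>2 * b - A\<bar>" for a b :: int
    by arith
  moreover have "2 * \<bar>a - int s\<bar> \<le> \<bar>2 * a - A\<bar> + (A - 2 * int s)" for a
    using assms(1) by arith
  ultimately show ?thesis
    using assms(2) unfolding spire_dist_def wt_def
    by (smt (verit, best))
qed

text \<open>The label differences telescope; each inner weight enters two gaps, the two end weights
  only one.\<close>

lemma sum_excess_telescope:
  fixes C f :: "nat \<Rightarrow> int"
  shows "(\<Sum>i<m. 2 * (C (Suc i) - C i) - 2 * N + f i + f (Suc i))
    = 2 * (C m - C 0) - 2 * int m * N + 2 * (\<Sum>i\<le>m. f i) - f 0 - f m"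
  by (induction m) (auto simp: algebra_simps)

text \<open>\<open>x\<close> lists the vertices by increasing label, and \<open>W i\<close> is twice the amount by which the
  \<open>i\<close>-th label gap exceeds the smallest one that the cut allows.\<close>
lemma radio_labeling_order:
  assumes n: "4 \<le> n" and s: "2 \<le> s" "s \<le> n - 2" and A: "2 * int s \<le> A"
    and rad: "radio_labeling (spire_verts n) (spire_edges n s) c"
  obtains x W where "bij_betw x {..<n} {1..n}"
    and "\<And>i. Suc i < n \<Longrightarrow>
      wt n s A (x i) + wt n s A (x (Suc i)) - 2 * spire_dist n s (x i) (x (Suc i)) \<le> W i"
    and "\<And>i. Suc (Suc i) < n \<Longrightarrow>
      2 * wt n s A (x (Suc i)) - 2 * (int n - 1) + (wt n s A (x i) + wt n s A (x (Suc (Suc i)))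
        - 2 * spire_dist n s (x i) (x (Suc (Suc i)))) \<le> W i + W (Suc i)"
    and "2 * (int n - 1)^2 - 2 * (\<Sum>v\<in>{1..n}. wt n s A v)
        + wt n s A (x 0) + wt n s A (x (n - 1)) + (\<Sum>i<n - 1. W i)
      \<le> 2 * (int (label_span (spire_verts n) c) - 1)"
proof -
  have pos: "0 < c v" if "v \<in> {1..n}" for v
    using rad that unfolding radio_labeling_spire_iff[OF n s] by blast
  have gap: "int n - 1 \<le> spire_dist n s u v + \<bar>int (c u) - int (c v)\<bar>"
    if "u \<in> {1..n}" "v \<in> {1..n}" "u \<noteq> v" for u v
    using rad that unfolding radio_labeling_spire_iff[OF n s] by blast
  define xs where "xs = sort_key c [1..<Suc n]"
  define x where "x i = xs ! i" for i
  have len: "length xs = n" and set: "set xs = {1..n}" and dist: "distinct xs"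
    by (auto simp: xs_def)
  have bij: "bij_betw x {..<n} {1..n}"
    using bij_betw_nth[OF dist] len set by (metis bij_betw_cong x_def)
  have ran: "x i \<in> {1..n}" if "i < n" for i
    using bij that by (auto dest: bij_betwE)
  have sorted: "c (x i) \<le> c (x j)" if "i \<le> j" "j < n" for i j
    using sorted_nth_mono[of "map c xs" i j] that len by (simp add: xs_def x_def)
  have neq: "x i \<noteq> x j" if "i < j" "j < n" for i j
    using dist that len by (simp add: x_def nth_eq_iff_index_eq)
  have step: "int n - 1 - spire_dist n s (x i) (x j) \<le> int (c (x j)) - int (c (x i))"
    if "i < j" "j < n" for i j
    using gap[OF ran ran neq, of i j] sorted[of i j] that by auto
  define W where "W i = 2 * (int (c (x (Suc i))) - int (c (x i))) - 2 * (int n - 1)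
    + wt n s A (x i) + wt n s A (x (Suc i))" for i
  have "(\<Sum>i<n - 1. W i) = 2 * (int (c (x (n - 1))) - int (c (x 0)))
      - 2 * int (n - 1) * (int n - 1) + 2 * (\<Sum>i\<le>n - 1. wt n s A (x i))
      - wt n s A (x 0) - wt n s A (x (n - 1))"
    unfolding W_def by (rule sum_excess_telescope)
  also have "(\<Sum>i\<le>n - 1. wt n s A (x i)) = (\<Sum>v\<in>{1..n}. wt n s A v)"
  proof -
    have "{..n - 1} = {..<n}" using n by auto
    then show ?thesis using sum.reindex_bij_betw[OF bij, of "wt n s A"] by simp
  qed
  finally have total: "(\<Sum>i<n - 1. W i) = 2 * (int (c (x (n - 1))) - int (c (x 0)))
      - 2 * (int n - 1)^2 + 2 * (\<Sum>v\<in>{1..n}. wt n s A v)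
      - wt n s A (x 0) - wt n s A (x (n - 1))"
    using n by (simp add: power2_eq_square of_nat_diff algebra_simps)
  have "c (x (n - 1)) \<le> label_span (spire_verts n) c"
    using ran[of "n - 1"] n by (auto simp: label_span_def spire_verts_def)
  \<comment> \<open>Labels start at 1, so the total label difference is at most the span minus
    1.\<close>
  moreover have "0 < c (x 0)" using pos ran[of 0] n by simp
  ultimately have span: "2 * (int n - 1)^2 - 2 * (\<Sum>v\<in>{1..n}. wt n s A v)
        + wt n s A (x 0) + wt n s A (x (n - 1)) + (\<Sum>i<n - 1. W i)
      \<le> 2 * (int (label_span (spire_verts n) c) - 1)"
    using total by (smt (verit, best) of_nat_0_less_iff of_nat_le_iff)
  have one: "wt n s A (x i) + wt n s A (x (Suc i)) - 2 * spire_dist n s (x i) (x (Suc i)) \<le> W i"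
    if "Suc i < n" for i
    using step[of i "Suc i"] that by (simp add: W_def)
  \<comment> \<open>The radio condition for positions \<open>i\<close> and \<open>i + 2\<close>: the
    two gaps add up to one label difference, and the middle weight enters both excesses.\<close>
  have two: "2 * wt n s A (x (Suc i)) - 2 * (int n - 1)
      + (wt n s A (x i) + wt n s A (x (Suc (Suc i)))
        - 2 * spire_dist n s (x i) (x (Suc (Suc i)))) \<le> W i + W (Suc i)"
    if "Suc (Suc i) < n" for i
    using step[of i "Suc (Suc i)"] that by (simp add: W_def)
  from that[OF bij one two span] show ?thesis .
qed

lemma spire_order_neq:
  assumes "bij_betw x {..<n} {1..n::nat}" "i < n" "j < n" "i \<noteq> j"
  shows "x i \<noteq> x j"
  using assms by (auto simp: bij_betw_def inj_on_def)

text \<open>Every excess is nonnegative by the triangle inequality through the cut, so only the two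
  end weights remain to be bounded.\<close>

lemma span_ge_weight:
  assumes n: "4 \<le> n" and s: "2 \<le> s" "s \<le> n - 2" and A: "2 * int s \<le> A"
    and rad: "radio_labeling (spire_verts n) (spire_edges n s) c"
  shows "(int n - 1)^2 - (\<Sum>v\<in>{1..n}. wt n s A v) + 2 \<le> int (label_span (spire_verts n) c)"
proof -
  obtain x W where bij: "bij_betw x {..<n} {1..n}"
    and one: "\<And>i. Suc i < n \<Longrightarrow>
      wt n s A (x i) + wt n s A (x (Suc i)) - 2 * spire_dist n s (x i) (x (Suc i)) \<le> W i"
    and span: "2 * (int n - 1)^2 - 2 * (\<Sum>v\<in>{1..n}. wt n s A v)
        + wt n s A (x 0) + wt n s A (x (n - 1)) + (\<Sum>i<n - 1. W i)
      \<le> 2 * (int (label_span (spire_verts n) c) - 1)"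
    using radio_labeling_order[OF n s A rad] by metis
  have "0 \<le> W i" if "i < n - 1" for i
    using one[of i] dist_le_wt[OF A spire_order_neq[OF bij, of i "Suc i"], of n] that by force
  then have "0 \<le> (\<Sum>i<n - 1. W i)" by (intro sum_nonneg) auto
  moreover have "x 0 \<noteq> x (n - 1)" using spire_order_neq[OF bij, of 0 "n - 1"] n by simp
  \<comment> \<open>Two distinct path vertices are at least one step apart, so their weights sum to
    at least 2; the pendant vertex alone weighs at least 2.\<close>
  then have "2 \<le> wt n s A (x 0) + wt n s A (x (n - 1))"
    using A by (auto simp: wt_def)
  ultimately show ?thesis using span by (smt (verit, best))
qed

section \<open>Total weight of the vertices\<close>

lemma wt_sum_left:
  fixes A :: int
  assumes "2 * int m \<le> A"
  shows "(\<Sum>v\<in>{1..m}. \<bar>2 * int v - A\<bar>) = int m * A - int m * (int m + 1)"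
  using assms by (induction m) (auto simp: algebra_simps)

lemma wt_sum_right:
  fixes A :: int
  assumes "A \<le> 2 * int m + 2"
  shows "(\<Sum>v\<in>{m + 1..m + l}. \<bar>2 * int v - A\<bar>)
    = int l * (2 * int m - A) + int l * (int l + 1)"
  using assms by (induction l) (auto simp: algebra_simps)

text \<open>The cut lies between \<open>m\<close> and \<open>m + 1\<close>, so the absolute values
  have constant sign on each side and both sides are arithmetic series.\<close>

lemma wt_sum:
  assumes m: "2 * int m \<le> A" "A \<le> 2 * int m + 2" and n: "n = m + l + 1"
  shows "(\<Sum>v\<in>{1..n}. wt n s A v) = int m * A - int m * (int m + 1)
    + int l * (2 * int m - A) + int l * (int l + 1) + A - 2 * int s + 2"
proof -
  have "{1..n} = insert n ({1..m} \<union> {m + 1..m + l})"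
    using n by auto
  also have "(\<Sum>v\<in>\<dots>. wt n s A v) = wt n s A n + (\<Sum>v\<in>{1..m} \<union> {m + 1..m + l}. wt n s A v)"
    using n by (subst sum.insert) auto
  also have "(\<Sum>v\<in>{1..m} \<union> {m + 1..m + l}. wt n s A v)
    = (\<Sum>v\<in>{1..m} \<union> {m + 1..m + l}. \<bar>2 * int v - A\<bar>)"
    using n by (intro sum.cong) (auto simp: wt_def)
  also have "\<dots> = (\<Sum>v\<in>{1..m}. \<bar>2 * int v - A\<bar>) + (\<Sum>v\<in>{m + 1..m + l}. \<bar>2 * int v - A\<bar>)"
    by (intro sum.union_disjoint) auto
  finally show ?thesis
    using wt_sum_left[OF m(1)] wt_sum_right[OF m(2), of l] by (simp add: wt_def)
qed

section \<open>Forced excess when \<open>n = 2k\<close> and \<open>s < k\<close>\<close>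

text \<open>The value of \<open>b\<close> flips at each of the other steps, so the parity of the
  number of flips decides whether the two ends agree.\<close>

lemma even_agreements_iff:
  "even (m + card {i. i < m \<and> b i = b (Suc i)}) \<longleftrightarrow> b 0 = (b m :: bool)"
proof (induction m)
  case (Suc m)
  have "{i. i < Suc m \<and> b i = b (Suc i)}
    = {i. i < m \<and> b i = b (Suc i)} \<union> (if b m = b (Suc m) then {m} else {})"
    by (auto simp: less_Suc_eq)
  then have "card {i. i < Suc m \<and> b i = b (Suc i)}
    = card {i. i < m \<and> b i = b (Suc i)} + (if b m = b (Suc m) then 1 else 0)"
    by (simp add: card_insert_if)
  with Suc show ?case by auto
qed simp

text \<open>Going through the cut covers the stretch from the nearer position to the cut twice, so
  the excess is twice the doubled distance from that position to the cut; \<open>n\<close> has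
  position \<open>s\<close> here. As \<open>A\<close> is odd, this is at least 2.\<close>

lemma same_side_excess:
  assumes "s < k" "n = 2 * k" "A = 2 * int k - 1" "u \<noteq> v"
    and "(u = n \<or> u < k) = (v = n \<or> v < k)"
  shows "2 \<le> wt n s A u + wt n s A v - 2 * spire_dist n s u v"
proof -
  consider "u = n" "v \<noteq> n" "v < k" | "u \<noteq> n" "v = n" "u < k"
    | "u \<noteq> n" "v \<noteq> n" "u < k" "v < k" | "u \<noteq> n" "v \<noteq> n" "k \<le> u" "k \<le> v"
    using assms(4,5) by (metis not_le)
  then show ?thesis
    using assms(1-4) unfolding wt_def spire_dist_def
    by cases (simp_all split: abs_split)
qed

text \<open>All positions involved, including the foot \<open>s\<close>, are at most
  \<open>k - 2\<close>, where the doubled distance to the cut is at least 3.\<close>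

lemma left_side_excess:
  assumes "s + 2 \<le> k" "n = 2 * k" "A = 2 * int k - 1" "u \<noteq> v"
    and "u = n \<or> u < k - 1" "v = n \<or> v < k - 1"
  shows "6 \<le> wt n s A u + wt n s A v - 2 * spire_dist n s u v"
proof -
  consider "u = n" "v \<noteq> n" "v + 2 \<le> k" | "u \<noteq> n" "v = n" "u + 2 \<le> k"
    | "u \<noteq> n" "v \<noteq> n" "u + 2 \<le> k" "v + 2 \<le> k"
    using assms by force
  then show ?thesis
    using assms(1-4) unfolding wt_def spire_dist_def
    by cases (simp_all split: abs_split)
qed

text \<open>If the neighbours of \<open>2 * k - 1\<close> in the ordering lie on the same side, their radio condition
  forces the excess; otherwise one of them lies on the same side as \<open>2 * k - 1\<close>.\<close>
lemma excess_at_far_end: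
  assumes k: "3 \<le> k" and s: "2 \<le> s" "s \<le> k - 1" and n: "n = 2 * k"
    and A: "A = 2 * int k - 1"
    and bij: "bij_betw x {..<n} {1..n}"
    and one: "\<And>i. Suc i < n \<Longrightarrow>
      wt n s A (x i) + wt n s A (x (Suc i)) - 2 * spire_dist n s (x i) (x (Suc i)) \<le> W i"
    and two: "\<And>i. Suc (Suc i) < n \<Longrightarrow>
      2 * wt n s A (x (Suc i)) - 2 * (int n - 1) + (wt n s A (x i) + wt n s A (x (Suc (Suc i)))
        - 2 * spire_dist n s (x i) (x (Suc (Suc i)))) \<le> W i + W (Suc i)"
    and p: "Suc (Suc p) < n" "x (Suc p) = 2 * k - 1"
  shows "2 \<le> W p + W (Suc p)"
proof -
  have A': "2 * int s \<le> A" using s A k by linarith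
  have neq: "x p \<noteq> x (Suc p)" "x (Suc p) \<noteq> x (Suc (Suc p))" "x p \<noteq> x (Suc (Suc p))"
    using spire_order_neq[OF bij, of p "Suc p"] spire_order_neq[OF bij, of "Suc p" "Suc (Suc p)"]
      spire_order_neq[OF bij, of p "Suc (Suc p)"] p by auto
  define L where "L v \<longleftrightarrow> v = n \<or> v < k" for v
  have same: "2 \<le> wt n s A u + wt n s A v - 2 * spire_dist n s u v"
    if "L u = L v" "u \<noteq> v" for u v
    using that s k by (intro same_side_excess[OF _ n A]) (auto simp: L_def)
  have nonneg: "0 \<le> wt n s A u + wt n s A v - 2 * spire_dist n s u v"
    if "u \<noteq> v" for u v
    using dist_le_wt[OF A' that, of n] by simp
  \<comment> \<open>The far end weighs exactly \<open>n - 1\<close>, so the first two terms of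
    \<open>two\<close> cancel.\<close>
  have far: "wt n s A (x (Suc p)) = int n - 1"
    using p(2) n k A by (auto simp: wt_def)
  \<comment> \<open>Of three vertices on two sides, two share a side.\<close>
  consider "L (x p) = L (x (Suc (Suc p)))" | "L (x p) = L (x (Suc p))"
    | "L (x (Suc p)) = L (x (Suc (Suc p)))"
    by blast
  then show ?thesis
  proof cases
    case 1
    from same[OF 1 neq(3)] two[OF p(1)] show ?thesis unfolding far by simp
  next
    case 2
    from same[OF 2 neq(1)] nonneg[OF neq(2)] one[of p] one[of "Suc p"] p(1) show ?thesis
      by simp
  next
    case 3
    from same[OF 3 neq(2)] nonneg[OF neq(1)] one[of p] one[of "Suc p"] p(1) show ?thesis
      by simp
  qed
qed

text \<open>Both bounds reduce to the quantity \<open>D\<close> of end weights plus total excess: it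
  is at least 4, and at least 6 if \<open>s\<close> is at most \<open>k - 2\<close>.\<close>

lemma span_ge_even:
  assumes k: "3 \<le> k" and s: "2 \<le> s" "s \<le> k - 1" and n: "n = 2 * k"
    and rad: "radio_labeling (spire_verts n) (spire_edges n s) c"
  shows "2 * (int k)^2 - 4 * int k + 2 * int s + 2 \<le> int (label_span (spire_verts n) c)"
    and "s \<le> k - 2 \<Longrightarrow>
      2 * (int k)^2 - 4 * int k + 2 * int s + 3 \<le> int (label_span (spire_verts n) c)"
proof -
  define A where "A = 2 * int k - 1"
  let ?f = "wt n s A"
  have A: "2 * int s \<le> A" using s A_def k by linarith
  have n4: "4 \<le> n" and sn: "s \<le> n - 2" using k s n by auto
  obtain x W where bij: "bij_betw x {..<n} {1..n}"
    and one: "\<And>i. Suc i < n \<Longrightarrow>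
      ?f (x i) + ?f (x (Suc i)) - 2 * spire_dist n s (x i) (x (Suc i)) \<le> W i"
    and two: "\<And>i. Suc (Suc i) < n \<Longrightarrow>
      2 * ?f (x (Suc i)) - 2 * (int n - 1) + (?f (x i) + ?f (x (Suc (Suc i)))
        - 2 * spire_dist n s (x i) (x (Suc (Suc i)))) \<le> W i + W (Suc i)"
    and span: "2 * (int n - 1)^2 - 2 * (\<Sum>v\<in>{1..n}. ?f v)
        + ?f (x 0) + ?f (x (n - 1)) + (\<Sum>i<n - 1. W i)
      \<le> 2 * (int (label_span (spire_verts n) c) - 1)"
    using radio_labeling_order[OF n4 s(1) sn A rad] by metis
  have neq: "x i \<noteq> x j" if "i < n" "j < n" "i \<noteq> j" for i j
    using spire_order_neq[OF bij that] .
  have pos: "\<exists>i<n. x i = v" if "v \<in> {1..n}" for v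
    using bij that unfolding bij_betw_def by (metis imageE lessThan_iff)
  have nonneg: "0 \<le> ?f u + ?f v - 2 * spire_dist n s u v" if "u \<noteq> v" for u v
    using dist_le_wt[OF A that, of n] by simp
  have W0: "0 \<le> W i" if "i < n - 1" for i
    using one[of i] nonneg[OF neq[of i "Suc i"]] that by force
  \<comment> \<open>As \<open>A\<close> is odd, no path vertex lies on the cut.\<close>
  have f1: "1 \<le> ?f v" for v
    using A unfolding wt_def A_def by auto presburger
  have sumW: "sum W B \<le> (\<Sum>i<n - 1. W i)" if "B \<subseteq> {..<n - 1}" for B
    using that W0 by (intro sum_mono2) auto
  have pairW: "W i + W (Suc i) \<le> (\<Sum>i<n - 1. W i)" if i: "Suc (Suc i) < n" for i
  proof -
    have "{i, Suc i} \<subseteq> {..<n - 1}" using i by auto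
    from sumW[OF this] show ?thesis by simp
  qed
  have F: "(\<Sum>v\<in>{1..n}. ?f v) = 2 * (int k)^2 - 2 * int s + 2"
    using wt_sum[of "k - 1" A n k s] k n
    by (simp add: A_def of_nat_diff algebra_simps power2_eq_square)
  have N: "2 * (int n - 1)^2 = 8 * (int k)^2 - 8 * int k + 2"
    using n by (simp add: algebra_simps power2_eq_square)
  define D where "D = ?f (x 0) + ?f (x (n - 1)) + (\<Sum>i<n - 1. W i)"
  have spanD: "4 * (int k)^2 - 8 * int k + 4 * int s + D
      \<le> 2 * int (label_span (spire_verts n) c)"
    using span unfolding D_def F N by (smt (verit, best))
  have sumW0: "0 \<le> (\<Sum>i<n - 1. W i)" using sumW[of "{}"] by simp
  obtain p' where p': "p' < n" "x p' = 2 * k - 1" using pos[of "2 * k - 1"] k n by fastforce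
  have ffar: "?f (2 * k - 1) = 2 * int k - 1"
    using k n by (auto simp: wt_def A_def)
  \<comment> \<open>If the far end comes first or last, its own weight makes \<open>D\<close> large
    and no excess is required.\<close>
  have ends: "2 * int k \<le> D" if "p' = 0 \<or> p' = n - 1"
    using that p'(2) ffar f1[of "x 0"] f1[of "x (n - 1)"] sumW0 by (auto simp: D_def)
  have inner: "\<exists>p. p' = Suc p \<and> Suc (Suc p) < n \<and> 2 \<le> W p + W (Suc p)"
    if p0: "p' \<noteq> 0" "p' \<noteq> n - 1"
  proof -
    obtain p where p: "p' = Suc p" using p0(1) by (cases p') auto
    have pn: "Suc (Suc p) < n" using p0(2) p'(1) p by simp
    have "2 \<le> W p + W (Suc p)"
      using p p'(2) by (intro excess_at_far_end[OF k s n A_def bij one two pn]) auto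
    with p pn show ?thesis by blast
  qed
  have "4 \<le> D"
  proof (cases "p' = 0 \<or> p' = n - 1")
    case True
    then show ?thesis using ends k by auto
  next
    case False
    then obtain p where p: "Suc (Suc p) < n" "2 \<le> W p + W (Suc p)" using inner by blast
    then show ?thesis using pairW[OF p(1)] f1[of "x 0"] f1[of "x (n - 1)"] by (simp add: D_def)
  qed
  then show "2 * (int k)^2 - 4 * int k + 2 * int s + 2 \<le> int (label_span (spire_verts n) c)"
    using spanD by linarith
  assume s2: "s \<le> k - 2"
  have "6 \<le> D"
  proof (rule ccontr)
    assume D: "\<not> 6 \<le> D"
    then have "\<not> 2 * int k \<le> D" using k by linarith
    then have "\<not> (p' = 0 \<or> p' = n - 1)" using ends by blast
    then have p0: "p' \<noteq> 0" "p' \<noteq> n - 1" by auto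
    then obtain p where p: "p' = Suc p" "Suc (Suc p) < n" "2 \<le> W p + W (Suc p)"
      using inner by blast
    have xp: "x (Suc p) = 2 * k - 1" using p p' by simp
    have "?f (x 0) + ?f (x (n - 1)) \<le> 3"
      using D p(3) pairW[OF p(2)] by (simp add: D_def)
    then have "?f (x 0) \<le> 2" "?f (x (n - 1)) \<le> 2"
      using f1[of "x 0"] f1[of "x (n - 1)"] by auto
    \<comment> \<open>The pendant vertex weighs \<open>2k - 2s + 1\<close>, which is at least 5, so
      only the two vertices beside the cut are light enough.\<close>
    moreover have near: "v = k - 1 \<or> v = k" if "?f v \<le> 2" for v
      using that s2 s k n by (auto simp: wt_def A_def split: if_splits)
    ultimately have xend: "x 0 = k - 1 \<or> x 0 = k" "x (n - 1) = k - 1 \<or> x (n - 1) = k"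
      by auto
    have W3: "(\<Sum>i<n - 1. W i) \<le> 3"
      using D f1[of "x 0"] f1[of "x (n - 1)"] by (simp add: D_def)
    define L where "L v \<longleftrightarrow> v = n \<or> v < k" for v
    have same: "2 \<le> ?f u + ?f v - 2 * spire_dist n s u v"
      if "L u = L v" "u \<noteq> v" for u v
      using that s k by (intro same_side_excess[OF _ n A_def]) (auto simp: L_def)
    have left: "6 \<le> ?f u + ?f v - 2 * spire_dist n s u v"
      if "L u" "L v" "u \<noteq> v" "u \<noteq> k - 1" "v \<noteq> k - 1" for u v
      using that s2 k by (intro left_side_excess[OF _ n A_def]) (auto simp: L_def)
    let ?S = "{i. i < n - 1 \<and> L (x i) = L (x (Suc i))}"
    have "2 \<le> W i" if i: "i \<in> ?S" for i
    proof -
      have "Suc i < n" "L (x i) = L (x (Suc i))" using i by auto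
      with same[of "x i" "x (Suc i)"] neq[of i "Suc i"] one[of i] show ?thesis by simp
    qed
    then have "(\<Sum>i\<in>?S. 2) \<le> (\<Sum>i\<in>?S. W i)" by (rule sum_mono)
    moreover have "(\<Sum>i\<in>?S. W i) \<le> 3" by (rule order_trans[OF sumW W3]) auto
    ultimately have card1: "card ?S \<le> 1" by simp
    have "x 0 \<noteq> x (n - 1)" using neq[of 0 "n - 1"] n4 by simp
    \<comment> \<open>The two ends are \<open>k - 1\<close> and \<open>k\<close>, on opposite sides.
      With \<open>n - 1\<close> odd, the number of same-side steps is even; being at most one, it is
      zero.\<close>
    then have "L (x 0) \<noteq> L (x (n - 1))" using xend k n by (auto simp: L_def)
    with even_agreements_iff[of "n - 1" "\<lambda>i. L (x i)"] have "even (card ?S)"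
      using n k by auto
    with card1 have "card ?S = 0" by (cases "card ?S") auto
    then have "?S = {}" by simp
    then have alt: "L (x i) \<noteq> L (x (Suc i))" if "i < n - 1" for i
      using that by blast
    have nb: "x p = k - 1 \<or> x (Suc (Suc p)) = k - 1"
    proof (rule ccontr)
      assume c: "\<not> ?thesis"
      have "\<not> L (x (Suc p))" using xp k n by (auto simp: L_def)
      then have "L (x p)" "L (x (Suc (Suc p)))" using alt[of p] alt[of "Suc p"] p(2) by auto
      then have "6 \<le> ?f (x p) + ?f (x (Suc (Suc p))) - 2 * spire_dist n s (x p) (x (Suc (Suc p)))"
        using left c neq[of p "Suc (Suc p)"] p(2) by auto
      with two[OF p(2)] have "6 \<le> W p + W (Suc p)"
        using ffar xp n by simp
      then show False using W3 pairW[OF p(2)] by simp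
    qed
    obtain q' where q': "q' < n" "x q' = 2 * k - 2" using pos[of "2 * k - 2"] k n by fastforce
    \<comment> \<open>The bounds on \<open>s\<close> give \<open>k\<close> at least 4, so
      \<open>2k - 2\<close> is not an end of the ordering either.\<close>
    have far: "2 * k - 2 \<noteq> k - 1" "2 * k - 2 \<noteq> k" using s s2 by auto
    have "q' \<noteq> 0" using q'(2) xend(1) far by metis
    moreover have q0: "q' \<noteq> n - 1" using q'(2) xend(2) far by metis
    ultimately obtain q where q1: "q' = Suc q" using not0_implies_Suc by blast
    with q0 q'(1) have q: "q' = Suc q" "Suc (Suc q) < n" by auto
    have xq: "x (Suc q) = 2 * k - 2" using q' q by simp
    have pq: "p \<noteq> q" using xp xq k by auto
    show False
    proof (cases "x q = k - 1 \<or> x (Suc (Suc q)) = k - 1")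
      case True
      \<comment> \<open>An end position has only one neighbouring position, so \<open>2k - 1\<close>
        and \<open>2k - 2\<close> cannot both be next to \<open>k - 1\<close>.\<close>
      have at_end: "i = 0 \<or> i = n - 1" if i: "x i = k - 1" "i < n" for i
      proof -
        have "x 0 = k - 1 \<or> x (n - 1) = k - 1"
          using xend \<open>x 0 \<noteq> x (n - 1)\<close> by auto
        moreover have "0 < n" "n - 1 < n" using n4 by auto
        ultimately show ?thesis using i neq by metis
      qed
      obtain i where i: "x i = k - 1" "i = p \<or> i = Suc (Suc p)" using nb by blast
      obtain j where j: "x j = k - 1" "j = q \<or> j = Suc (Suc q)" using True by blast
      have "i < n" "j < n" using i j p(2) q(2) by auto
      then have "i = j" using neq i(1) j(1) by metis
      moreover have "i = 0 \<or> i = n - 1" using at_end i \<open>i < n\<close> by blast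
      ultimately show False using i(2) j(2) pq p(2) q(2) by linarith
    next
      case False
      have Rq: "\<not> L (x (Suc q))" "\<not> L (x (Suc p))" using xp xq k n by (auto simp: L_def)
      then have Lq: "L (x q)" "L (x (Suc (Suc q)))" using alt[of q] alt[of "Suc q"] q(2) by auto
      then have "6 \<le> ?f (x q) + ?f (x (Suc (Suc q))) - 2 * spire_dist n s (x q) (x (Suc (Suc q)))"
        using left False neq[of q "Suc (Suc q)"] q(2) by auto
      \<comment> \<open>This weight falls short of \<open>n - 1\<close> by 2, which costs 4 of the 6
        in \<open>two\<close> and leaves an excess of 2.\<close>
      moreover have "?f (x (Suc q)) = 2 * int k - 3"
        using xq k n by (auto simp: wt_def A_def)
      ultimately have Wq: "2 \<le> W q + W (Suc q)" using two[OF q(2)] n by simp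
      \<comment> \<open>Two right-hand vertices are never consecutive, so the two pairs of gaps are
        disjoint and their excesses add up to at least 4.\<close>
      have "p \<noteq> Suc q" "q \<noteq> Suc p"
        using Rq alt[of "Suc q"] alt[of "Suc p"] p(2) q(2) by auto
      then have "sum W {p, Suc p, q, Suc q} = W p + W (Suc p) + (W q + W (Suc q))"
        using pq by simp
      moreover have "{p, Suc p, q, Suc q} \<subseteq> {..<n - 1}" using p(2) q(2) by auto
      ultimately show False using sumW[of "{p, Suc p, q, Suc q}"] p(3) Wq W3 by simp
    qed
  qed
  then show "2 * (int k)^2 - 4 * int k + 2 * int s + 3 \<le> int (label_span (spire_verts n) c)"
    using spanD by linarith
qed

section \<open>Optimal labelings\<close>

text \<open>Replaces the products of block numbers with the block length by linear facts. Blocks two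
  or more apart need only the crude gap \<open>2 * P\<close>.\<close>

lemma mult_gap:
  fixes a b P :: int
  assumes "0 \<le> P"
  shows "a = b \<and> a * P = b * P \<or> b = a + 1 \<and> b * P = a * P + P
    \<or> a = b + 1 \<and> a * P = b * P + P
    \<or> a + 2 \<le> b \<and> a * P + 2 * P \<le> b * P \<or> b + 2 \<le> a \<and> b * P + 2 * P \<le> a * P"
proof -
  have gap: "c * P + 2 * P \<le> d * P" if "c + 2 \<le> d" for c d
    using mult_right_mono[OF that assms] by (simp add: distrib_right)
  consider "a = b" | "b = a + 1" | "a = b + 1" | "a + 2 \<le> b" | "b + 2 \<le> a"
    by linarith
  then show ?thesis
    by cases (use gap in \<open>auto simp: distrib_right\<close>)
qed

text \<open>A labeling is given by blocks: vertex \<open>v\<close> gets the label \<open>t v\<close> within block \<open>b v\<close>, where the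
  blocks have length \<open>P\<close>. The products enter the hypotheses only through \<open>X\<close> and \<open>Y\<close>,
  which keeps these hypotheses linear.\<close>
lemma spire_rn_le_blocks:
  fixes b t :: "int \<Rightarrow> int"
  assumes n: "4 \<le> n" and s: "2 \<le> s" "s \<le> n - 2" and P: "0 \<le> P"
    and range: "\<And>v. 1 \<le> v \<Longrightarrow> v \<le> int n \<Longrightarrow> 0 \<le> b v \<and> b v \<le> B"
    and bounds: "\<And>v. 1 \<le> v \<Longrightarrow> v \<le> int n \<Longrightarrow> 1 \<le> t v \<or> 1 \<le> b v \<and> 1 \<le> P + t v"
    and max: "\<And>v. 1 \<le> v \<Longrightarrow> v \<le> int n \<Longrightarrow> t v \<le> T \<or> b v < B \<and> t v \<le> P + T"
    and path: "\<And>u v X Y. 1 \<le> u \<Longrightarrow> u < v \<Longrightarrow> v < int n \<Longrightarrow>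
      b u = b v \<and> X = Y \<or> b v = b u + 1 \<and> Y = X + P \<or> b u = b v + 1 \<and> X = Y + P
        \<or> b u + 2 \<le> b v \<and> X + 2 * P \<le> Y \<or> b v + 2 \<le> b u \<and> Y + 2 * P \<le> X \<Longrightarrow>
      int n - 1 \<le> v - u + \<bar>X + t u - (Y + t v)\<bar>"
    and pendant: "\<And>u X Y. 1 \<le> u \<Longrightarrow> u < int n \<Longrightarrow>
      b u = b (int n) \<and> X = Y \<or> b (int n) = b u + 1 \<and> Y = X + P
        \<or> b u = b (int n) + 1 \<and> X = Y + P
        \<or> b u + 2 \<le> b (int n) \<and> X + 2 * P \<le> Y \<or> b (int n) + 2 \<le> b u \<and> Y + 2 * P \<le> X \<Longrightarrow>
      int n - 1 \<le> \<bar>u - int s\<bar> + 1 + \<bar>X + t u - (Y + t (int n))\<bar>"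
  shows "int (spire_rn n s) \<le> B * P + T"
proof (rule spire_rn_le[where C = "\<lambda>v. b (int v) * P + t (int v)"])
  fix v assume v: "v \<in> {1..n}"
  then have v': "1 \<le> int v" "int v \<le> int n" by auto
  \<comment> \<open>An offset may be nonpositive or exceed \<open>T\<close>; the block number then
    leaves room for one more block length.\<close>
  have "0 \<le> b (int v) * P" using range[OF v'] P by simp
  moreover have "1 * P \<le> b (int v) * P" if "1 \<le> b (int v)"
    using mult_right_mono[OF that P] .
  ultimately show "1 \<le> b (int v) * P + t (int v)" using bounds[OF v'] by force
  have "b (int v) * P \<le> B * P" using range[OF v'] P by (simp add: mult_right_mono)
  moreover have "b (int v) * P + P \<le> B * P" if "b (int v) < B"
    using that P mult_right_mono[of "b (int v) + 1" B P] by (simp add: distrib_right)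
  ultimately show "b (int v) * P + t (int v) \<le> B * P + T" using max[OF v'] by force
next
  fix u v assume uv: "u \<in> {1..n}" "v \<in> {1..n}" "u < v"
  show "int n - 1 \<le> spire_dist n s u v
    + \<bar>b (int u) * P + t (int u) - (b (int v) * P + t (int v))\<bar>"
  proof (cases "v = n")
    case True
    then show ?thesis
      using pendant[OF _ _ mult_gap[OF P], of "int u"] uv by (simp add: spire_dist_def)
  next
    case False
    then show ?thesis
      using path[OF _ _ _ mult_gap[OF P], of "int u" "int v"] uv by (simp add: spire_dist_def)
  qed
qed (use n s in auto)

text \<open>Vertices by increasing label: \<open>k, 2k, k-2, 2k-2, k-3, 2k-3, \<dots>, 1, k+1, n, 2k-1, k-1\<close>.\<close>
lemma spire_rn_odd_le:
  assumes s: "2 \<le> s" "s \<le> k" and n: "n = 2 * k + 1"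
  shows "int (spire_rn n s) \<le> 2 * (int k)^2 - 2 * int k + 2 * int s"
proof -
  define K S where KS: "K = int k" "S = int s"
  \<comment> \<open>One period consists of the tight gaps \<open>k\<close> from \<open>v\<close> to
    \<open>v + k\<close> and \<open>k - 1\<close> from \<open>v + k\<close> to \<open>v - 1\<close>.
    The closing gaps around \<open>n\<close> are tight as well.\<close>
  define P where "P = 2 * K - 1"
  define b where "b v = (if v = K \<or> v = 2 * K then 0
     else if v = 2 * K + 1 \<or> v = 2 * K - 1 \<or> v = K - 1 then K - 2
     else if v < K then K - 1 - v else 2 * K - 1 - v)" for v
  define t where "t v = (if v = K then 1 else if v = 2 * K then K + 1
     else if v = 2 * K + 1 then 2 * K - 2 + S
     else if v = 2 * K - 1 then 2 * K - 2 + 2 * S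
     else if v = K - 1 then 3 * K - 2 + 2 * S
     else if v < K then 0 else K)" for v
  have nK: "int n = 2 * K + 1" using n KS by simp
  have S: "2 \<le> S" "S \<le> K" using s KS by auto
  \<comment> \<open>As a disjunction of linear descriptions, this leaves one linear problem per pair
    of cases.\<close>
  have blocks: "w = K \<and> b w = 0 \<and> t w = 1
    \<or> w = 2 * K \<and> b w = 0 \<and> t w = K + 1
    \<or> w = 2 * K - 1 \<and> b w = K - 2 \<and> t w = 2 * K - 2 + 2 * S
    \<or> w = K - 1 \<and> b w = K - 2 \<and> t w = 3 * K - 2 + 2 * S
    \<or> w \<le> K - 2 \<and> b w = K - 1 - w \<and> t w = 0
    \<or> K + 1 \<le> w \<and> w \<le> 2 * K - 2 \<and> b w = 2 * K - 1 - w \<and> t w = K"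
    if "1 \<le> w" "w < int n" for w
    using that S unfolding nK by (auto simp: b_def t_def)
  have last: "b (int n) = K - 2" "t (int n) = 2 * K - 2 + S"
    using S by (auto simp: nK b_def t_def)
  have "int (spire_rn n s) \<le> (K - 2) * P + (3 * K - 2 + 2 * S)"
  proof (rule spire_rn_le_blocks[where b = b and t = t], goal_cases)
    case (5 v)
    then show ?case using S unfolding nK b_def by auto
  next
    case (6 v)
    then show ?case using S unfolding nK by (auto simp: b_def t_def P_def)
  next
    case (7 v)
    then show ?case using S unfolding nK by (auto simp: b_def t_def P_def)
  next
    case (8 u v X Y)
    have "u < int n" "1 \<le> v" using 8 by auto
    from blocks[OF 8(1) this(1)] blocks[OF this(2) 8(3)] 8 S P_def nK show ?case
      by (elim disjE conjE; linarith)
  next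
    case (9 u X Y)
    from blocks[OF 9(1,2)] 9 last S P_def nK KS(2) show ?case
      by (elim disjE conjE; linarith)
  qed (use s n KS P_def in auto)
  then show ?thesis
    unfolding KS P_def by (simp add: algebra_simps power2_eq_square)
qed

text \<open>Vertices by increasing label: \<open>k, 2k-1, k-1, 2k-2, \<dots>, 2, k+1, 1, n\<close>.\<close>
lemma spire_rn_even_centre_le:
  assumes k: "2 \<le> k" and n: "n = 2 * k"
  shows "int (spire_rn n k) \<le> 2 * (int k)^2 - 2 * int k + 1"
proof -
  define K where K: "K = int k"
  \<comment> \<open>The period consists of the gaps \<open>k\<close> from \<open>v\<close> to
    \<open>v + k - 1\<close> and \<open>k - 1\<close> from there to \<open>v - 1\<close>.\<close>
  define P where "P = 2 * K - 1"
  define b where "b v = (if v = 2 * K then K - 1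
     else if v \<le> K then K - v else 2 * K - 1 - v)" for v
  define t where "t v = (if v = 2 * K then K else if v \<le> K then 1 else K + 1)" for v
  have nK: "int n = 2 * K" using n K by simp
  have K2: "2 \<le> K" using k K by auto
  have "int (spire_rn n k) \<le> (K - 1) * P + K"
  proof (rule spire_rn_le_blocks[where b = b and t = t], goal_cases)
    case (5 v)
    then show ?case using K2 unfolding nK b_def by auto
  next
    case (6 v)
    then show ?case using K2 unfolding nK by (auto simp: b_def t_def P_def)
  next
    case (7 v)
    then show ?case using K2 unfolding nK by (auto simp: b_def t_def P_def)
  next
    case (8 u v X Y)
    then show ?case using K2 unfolding nK by (auto simp: b_def t_def P_def)
  next
    case (9 u X Y)
    then show ?case using K2 unfolding nK K[symmetric] b_def t_def P_def by (smt (verit))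
  qed (use k n K P_def in auto)
  then show ?thesis
    unfolding K P_def by (simp add: algebra_simps power2_eq_square)
qed

text \<open>Vertices by increasing label: \<open>k-1, 2k-1, n, 2k-2, k-2, 2k-3, k-3, \<dots>, k+1, 1, k\<close>.\<close>
lemma spire_rn_even_near_centre_le:
  assumes k: "3 \<le> k" and n: "n = 2 * k" and s: "s = k - 1"
  shows "int (spire_rn n s) \<le> 2 * (int k)^2 - 2 * int k"
proof -
  define K where K: "K = int k"
  define P where "P = 2 * K - 1"
  define b where "b v = (if v = K - 1 \<or> v = 2 * K - 1 then 0 else if v = 2 * K then 1
     else if v < K then K - v else 2 * K - 1 - v)" for v
  \<comment> \<open>All consecutive gaps are tight except the one from \<open>2k - 1\<close> to
    \<open>n\<close>, larger by one: \<open>k - 1\<close> and \<open>n\<close> are adjacent in the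
    graph and two apart in the ordering.\<close>
  define t where "t v = (if v = K - 1 then 1 else if v = 2 * K - 1 then K
     else if v = 2 * K then 0 else if v < K then -1 else K - 1)" for v
  have nK: "int n = 2 * K" using n K by simp
  have K3: "3 \<le> K" using k K by auto
  have sK: "int s = K - 1" using k s K by auto
  have blocks: "w = K - 1 \<and> b w = 0 \<and> t w = 1
    \<or> w = 2 * K - 1 \<and> b w = 0 \<and> t w = K
    \<or> w \<le> K - 2 \<and> b w = K - w \<and> t w = -1
    \<or> K \<le> w \<and> w \<le> 2 * K - 2 \<and> b w = 2 * K - 1 - w \<and> t w = K - 1"
    if "1 \<le> w" "w < int n" for w
    using that K3 unfolding nK by (auto simp: b_def t_def)
  have last: "b (int n) = 1" "t (int n) = 0"
    using K3 by (auto simp: nK b_def t_def)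
  have "int (spire_rn n s) \<le> (K - 1) * P + (K - 1)"
  proof (rule spire_rn_le_blocks[where b = b and t = t], goal_cases)
    case (5 v)
    then show ?case using K3 unfolding nK b_def by auto
  next
    case (6 v)
    then show ?case using K3 unfolding nK by (auto simp: b_def t_def P_def)
  next
    case (7 v)
    then show ?case using K3 unfolding nK by (auto simp: b_def t_def P_def)
  next
    case (8 u v X Y)
    have "u < int n" "1 \<le> v" using 8 by auto
    from blocks[OF 8(1) this(1)] blocks[OF this(2) 8(3)] 8 K3 P_def nK show ?case
      by (elim disjE conjE; linarith)
  next
    case (9 u X Y)
    from blocks[OF 9(1,2)] 9 last K3 P_def nK sK show ?case
      by (elim disjE conjE; linarith)
  qed (use k n s K P_def in auto)
  then show ?thesis
    unfolding K P_def by (simp add: algebra_simps power2_eq_square)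
qed

text \<open>Vertices by increasing label: \<open>k-1, 2k-1, 2, k+1, n, 2k-2, k-2, 2k-3,
  k-3, \<dots>, 3, k+2, 1, k\<close>.\<close>
lemma spire_rn_even_le:
  assumes s: "2 \<le> s" "s + 2 \<le> k" and n: "n = 2 * k"
  shows "int (spire_rn n s) \<le> 2 * (int k)^2 - 4 * int k + 2 * int s + 3"
proof -
  define K S where KS: "K = int k" "S = int s"
  define P where "P = 2 * K - 1"
  define b where "b v = (if v = K - 1 \<or> v = 2 * K - 1 \<or> v = 2 \<or> v = K + 1 \<or> v = 2 * K then 0
     else if v = 1 \<or> v = K then K - 4
     else if v < K then K - 2 - v else 2 * K - 2 - v)" for v
  \<comment> \<open>Two consecutive gaps exceed the minimum by one: from \<open>2k - 1\<close> to
    \<open>2\<close>, because of the pair \<open>k - 1\<close>, \<open>2\<close>, and from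
    \<open>n\<close> to \<open>2k - 2\<close>.\<close>
  define t where "t v = (if v = K - 1 then 1 else if v = 2 * K - 1 then K
     else if v = 2 then K + 3 else if v = K + 1 then 2 * K + 3
     else if v = 2 * K then 3 * K + S
     else if v = 1 then 4 * K + 2 * S - 1 else if v = K then 5 * K + 2 * S - 1
     else if v < K then 4 * K + 2 * S else 3 * K + 2 * S + 1)" for v
  have nK: "int n = 2 * K" using n KS by simp
  have S: "2 \<le> S" "S + 2 \<le> K" using s KS by auto
  have blocks: "w = K - 1 \<and> b w = 0 \<and> t w = 1
    \<or> w = 2 * K - 1 \<and> b w = 0 \<and> t w = K
    \<or> w = 2 \<and> b w = 0 \<and> t w = K + 3
    \<or> w = K + 1 \<and> b w = 0 \<and> t w = 2 * K + 3
    \<or> w = 1 \<and> b w = K - 4 \<and> t w = 4 * K + 2 * S - 1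
    \<or> w = K \<and> b w = K - 4 \<and> t w = 5 * K + 2 * S - 1
    \<or> 3 \<le> w \<and> w \<le> K - 2 \<and> b w = K - 2 - w \<and> t w = 4 * K + 2 * S
    \<or> K + 2 \<le> w \<and> w \<le> 2 * K - 2 \<and> b w = 2 * K - 2 - w \<and> t w = 3 * K + 2 * S + 1"
    if "1 \<le> w" "w < int n" for w
    using that S unfolding nK by (auto simp: b_def t_def)
  have last: "b (int n) = 0" "t (int n) = 3 * K + S"
    using S by (auto simp: nK b_def t_def)
  have "int (spire_rn n s) \<le> (K - 4) * P + (5 * K + 2 * S - 1)"
  proof (rule spire_rn_le_blocks[where b = b and t = t], goal_cases)
    case (5 v)
    then show ?case using S unfolding nK b_def by auto
  next
    case (6 v)
    then show ?case using S unfolding nK by (auto simp: b_def t_def P_def)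
  next
    case (7 v)
    then show ?case using S unfolding nK by (auto simp: b_def t_def P_def)
  next
    case (8 u v X Y)
    have "u < int n" "1 \<le> v" using 8 by auto
    from blocks[OF 8(1) this(1)] blocks[OF this(2) 8(3)] 8 S P_def nK show ?case
      by (elim disjE conjE; linarith)
  next
    case (9 u X Y)
    from blocks[OF 9(1,2)] 9 last S P_def nK KS(2) show ?case
      by (elim disjE conjE; linarith)
  qed (use s n KS P_def in auto)
  then show ?thesis
    unfolding KS P_def by (simp add: algebra_simps power2_eq_square)
qed

section \<open>The radio number\<close>

text \<open>The cut at the vertex \<open>k\<close> leaves \<open>k\<close> path vertices up to the
  cut and \<open>k\<close> beyond it, and the weight bound alone meets the labeling.\<close>

lemma spire_rn_odd:
  assumes s: "2 \<le> s" "s \<le> k" and n: "n = 2 * k + 1"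
  shows "int (spire_rn n s) = 2 * (int k)^2 - 2 * int k + 2 * int s"
proof (rule antisym[OF spire_rn_odd_le[OF assms]])
  have n4: "4 \<le> n" "s \<le> n - 2" and A: "2 * int s \<le> 2 * int k" using s n by auto
  have "(int n - 1)^2 - (\<Sum>v\<in>{1..n}. wt n s (2 * int k) v) + 2
      = 2 * (int k)^2 - 2 * int k + 2 * int s"
    using wt_sum[of k "2 * int k" n k s] n by (simp add: algebra_simps power2_eq_square)
  with le_spire_rn[OF n4(1) s(1) n4(2) span_ge_weight[OF n4(1) s(1) n4(2) A]]
  show "2 * (int k)^2 - 2 * int k + 2 * int s \<le> int (spire_rn n s)" by simp
qed

lemma spire_rn_even_centre:
  assumes k: "2 \<le> k" and n: "n = 2 * k"
  shows "int (spire_rn n k) = 2 * (int k)^2 - 2 * int k + 1"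
proof (rule antisym[OF spire_rn_even_centre_le[OF assms]])
  have n4: "4 \<le> n" "k \<le> n - 2" and A: "2 * int k \<le> 2 * int k" using k n by auto
  have "n = k + (k - 1) + 1" using n k by simp
  then have "(int n - 1)^2 - (\<Sum>v\<in>{1..n}. wt n k (2 * int k) v) + 2
      = 2 * (int k)^2 - 2 * int k + 1"
    using wt_sum[of k "2 * int k" n "k - 1" k] n k
    by (simp add: of_nat_diff algebra_simps power2_eq_square)
  with le_spire_rn[OF n4(1) k n4(2) span_ge_weight[OF n4(1) k n4(2) A]]
  show "2 * (int k)^2 - 2 * int k + 1 \<le> int (spire_rn n k)" by simp
qed

text \<open>With \<open>s = k - 1\<close> the weaker of the two even bounds is already
  attained.\<close>

lemma spire_rn_even_near_centre:
  assumes k: "3 \<le> k" and n: "n = 2 * k" and s: "s = k - 1"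
  shows "int (spire_rn n s) = 2 * (int k)^2 - 2 * int k"
proof (rule antisym[OF spire_rn_even_near_centre_le[OF assms]])
  have h: "4 \<le> n" "2 \<le> s" "s \<le> n - 2" "s \<le> k - 1" using k n s by auto
  have "2 * (int k)^2 - 4 * int k + 2 * int s + 2 \<le> int (spire_rn n s)"
    using le_spire_rn[OF h(1-3) span_ge_even(1)[OF k h(2,4) n]] .
  then show "2 * (int k)^2 - 2 * int k \<le> int (spire_rn n s)"
    using s k by (simp add: of_nat_diff)
qed

lemma spire_rn_even:
  assumes s: "2 \<le> s" "s + 2 \<le> k" and n: "n = 2 * k"
  shows "int (spire_rn n s) = 2 * (int k)^2 - 4 * int k + 2 * int s + 3"
proof (rule antisym[OF spire_rn_even_le[OF assms]])
  have h: "4 \<le> n" "2 \<le> s" "s \<le> n - 2" and k: "3 \<le> k" "s \<le> k - 1" "s \<le> k - 2"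
    using s n by auto
  show "2 * (int k)^2 - 4 * int k + 2 * int s + 3 \<le> int (spire_rn n s)"
    using le_spire_rn[OF h span_ge_even(2)[OF k(1) h(2) k(2) n _ k(3)]] .
qed

theorem mainTheorem1:
  fixes n s :: nat
  assumes "4 \<le> n" and "2 \<le> s" and "s \<le> n div 2"
  shows "\<forall>k::nat.
    (n = 2 * k \<and> 2 \<le> s \<and> int s \<le> int k - 2 \<longrightarrow>
       int (spire_rn n s) = 2 * (int k)^2 - 4 * int k + 2 * int s + 3) \<and>
    (n = 2 * k \<and> int s = int k - 1 \<longrightarrow>
       int (spire_rn n s) = 2 * (int k)^2 - 2 * int k) \<and>
    (n = 2 * k \<and> s = k \<longrightarrow>
       int (spire_rn n s) = 2 * (int k)^2 - 2 * int k + 1) \<and>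
    (n = 2 * k + 1 \<longrightarrow>
       int (spire_rn n s) = 2 * (int k)^2 - 2 * int k + 2 * int s)"
proof (intro allI conjI impI)
  fix k assume "n = 2 * k \<and> 2 \<le> s \<and> int s \<le> int k - 2"
  then show "int (spire_rn n s) = 2 * (int k)^2 - 4 * int k + 2 * int s + 3"
    using assms by (intro spire_rn_even) auto
next
  fix k assume "n = 2 * k \<and> int s = int k - 1"
  then show "int (spire_rn n s) = 2 * (int k)^2 - 2 * int k"
    using assms by (intro spire_rn_even_near_centre) auto
next
  fix k assume "n = 2 * k \<and> s = k"
  then show "int (spire_rn n s) = 2 * (int k)^2 - 2 * int k + 1"
    using assms spire_rn_even_centre by blast
next
  fix k assume "n = 2 * k + 1"
  then show "int (spire_rn n s) = 2 * (int k)^2 - 2 * int k + 2 * int s"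
    using assms by (intro spire_rn_odd) auto
qed

end
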